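(* Consider a three-level non-degenerate quantum system whose state space is spanned by the orthonormal eigenvectors $|\lambda\rangle,|\tilde\lambda\rangle,|{-\lambda}\rangle$ of an observable $\hat A$, with respective eigenvalues $\lambda,\tilde\lambda,-\lambda$. Let $\theta$ be the parameter to be estimated, lying close to its true value $\theta_0$, with $\delta_\theta=\theta-\theta_0$, $|\delta_\theta|\ll1$, and let $\hat U(t)=e^{-i\hat A t}$. Let $\alpha$ and $\phi$ be real parameters. Postselect with $\hat F=|f_1\rangle\langle f_1|+|f_2\rangle\langle f_2|$, where $$|f_1\rangle=\frac{|\lambda\rangle-|{-\lambda}\rangle}{\sqrt2},\qquad |f_2\rangle=\frac{\cos\alpha\,|\lambda\rangle+\cos\alpha\,|{-\lambda}\rangle}{\sqrt2}+\sin\alpha\,|\tilde\lambda\rangle ,$$ and take the initial state $$|\psi_i\rangle=\frac{1}{\sqrt2}\,\hat U(\theta_0)^\dagger\left[(\cos\phi+i\sin\phi)|\lambda\rangle+(\cos\phi-i\sin\phi)|{-\lambda}\rangle\right].$$ Then the total postselection probability $p_\theta^{ps}$, the efficiency $\xi=p_\theta^{ps}\,\mathcal{I}_Q(\theta|\psi_\theta^{ps})$ and the weak values $A_w^1,A_w^2$ are $$p_\theta^{ps}=\sin^2(\phi-\lambda\delta_\theta)+\cos^2\alpha\cos^2(\phi-\lambda\delta_\theta),$$ $$p_\theta^{ps}\,\mathcal{I}_Q(\theta|\psi_\theta^{ps})=\frac{4\lambda^2\cos^2\alpha}{\sin^2(\phi-\lambda\delta_\theta)+\cos^2\alpha\cos^2(\phi-\lambda\delta_\theta)},$$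 $$A_w^1=\frac{i\lambda\cos(\phi-\lambda\delta_\theta)}{\sin(\phi-\lambda\delta_\theta)},\qquad A_w^2=\frac{-i\lambda\sin(\phi-\lambda\delta_\theta)}{\cos(\phi-\lambda\delta_\theta)} .$$ As $\phi\to\lambda\delta_\theta$ the condition for optimal quantum advantage gets satisfied, with $$\lim_{\phi\to\lambda\delta_\theta}p_\theta^{ps}=\cos^2\alpha,\qquad \lim_{\phi\to\lambda\delta_\theta}\mathcal{I}_Q(\theta|\psi_\theta^{ps})=4\lambda^2\sec^2\alpha,\qquad \lim_{\phi\to\lambda\delta_\theta}\xi=4\lambda^2 ;$$ thus in this limit the protocol is information preserving.
   Context: Write $|\psi_\theta\rangle=\hat U(\theta)|\psi_i\rangle$, $|\Psi_\theta^{ps}\rangle=\hat F|\psi_\theta\rangle$, $|\dot\Psi_\theta^{ps}\rangle=\partial_\theta|\Psi_\theta^{ps}\rangle$ (with $\theta_0,\phi,\alpha$ held fixed), and $p_\theta^{ps}=\langle\psi_\theta|\hat F|\psi_\theta\rangle$. The postselected quantum Fisher information is $$\mathcal{I}_Q(\theta|\psi_\theta^{ps})=\frac{4}{p_\theta^{ps}}\langle\dot\Psi_\theta^{ps}|\dot\Psi_\theta^{ps}\rangle-\frac{4}{(p_\theta^{ps})^2}\left|\langle\dot\Psi_\theta^{ps}|\Psi_\theta^{ps}\rangle\right|^2 .$$ The weak values are $A_w^k=\langle\psi_\theta|\hat A|f_k\rangle/\langle\psi_\theta|f_k\rangle$. The condition for optimal quantum advantage is that $\langle\psi_i|\hat A|\psi_i\rangle=0$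 and that $A_w^k=0$ for every vector $|f_k\rangle$ of the postselection basis not included in $\hat F$ (here, the unit vector $|f_3\rangle$ completing $|f_1\rangle,|f_2\rangle$ to an orthonormal basis). A postselected metrology protocol is called information preserving when, under this condition, its efficiency saturates the general bound $\xi\le4\|\hat A^2\|_{\mathrm{op}}$, where $\|\hat X\|_{\mathrm{op}}=\sup\{\langle\phi|\hat X|\phi\rangle:\langle\phi|\phi\rangle=1\}$.
   Formalization: Limits of I_Q and ξ need cos α≠0; the optimal-advantage condition needs sin α≠0 (else the third weak value is 0/0); information preservation needs both and |λ̃|≤|λ| (else ‖A²‖=λ̃²>λ²); ξ and the weak values are stated where their denominators are nonzero. *)

theory Defs
  imports "HOL-Analysis.Analysis"
begin

text \<open>The state space is \<open>complex ^ 'n\<close> with the inner product conjugate-linear in the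
  first argument; the inner product \<open>\<bullet>\<close> of the library on this type is only its real part.
  Operators are square complex matrices.\<close>

definition braket :: "complex ^ 'n \<Rightarrow> complex ^ 'n \<Rightarrow> complex" where
  "braket x y = (\<Sum>i\<in>UNIV. cnj (x $ i) * y $ i)"

definition orthonormal :: "(complex ^ 'n) list \<Rightarrow> bool" where
  "orthonormal vs \<longleftrightarrow>
     (\<forall>i < length vs. \<forall>j < length vs. braket (vs ! i) (vs ! j) = (if i = j then 1 else 0))"

definition projector :: "complex ^ 'n \<Rightarrow> complex ^ 'n ^ 'n" where
  "projector f = (\<chi> i j. f $ i * cnj (f $ j))"

definition adjoint_mat :: "complex ^ 'n ^ 'n \<Rightarrow> complex ^ 'n ^ 'n" where
  "adjoint_mat X = (\<chi> i j. cnj (X $ j $ i))"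

text \<open>On type \<open>complex ^ 'n ^ 'n\<close> the library operations \<open>*\<close> and \<open>^\<close> are componentwise, so the
  powers in the exponential series are written as iterated matrix products.\<close>

definition mat_exp :: "complex ^ 'n ^ 'n \<Rightarrow> complex ^ 'n ^ 'n" where
  "mat_exp X = (\<Sum>k. (1 / fact k) *\<^sub>R (((**) X) ^^ k) (mat 1))"

definition evolution :: "complex ^ 'n ^ 'n \<Rightarrow> real \<Rightarrow> complex ^ 'n ^ 'n" where
  "evolution A t = mat_exp (\<chi> i j. - \<i> * of_real t * A $ i $ j)"

text \<open>The real part in \<open>postsel_prob\<close>, \<open>postsel_qfi\<close> and \<open>op_norm\<close> is only a coercion: for
  self-adjoint operators the quantities are real.\<close>

definition postsel_prob :: "complex ^ 'n ^ 'n \<Rightarrow> complex ^ 'n \<Rightarrow> real" where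
  "postsel_prob F \<psi> = Re (braket \<psi> (F *v \<psi>))"

text \<open>Here \<open>\<psi>\<close> is the curve of states, as a function of the estimated parameter.\<close>

definition postsel_qfi :: "complex ^ 'n ^ 'n \<Rightarrow> (real \<Rightarrow> complex ^ 'n) \<Rightarrow> real \<Rightarrow> real" where
  "postsel_qfi F \<psi> \<theta> =
     (let \<Psi> = (\<lambda>t. F *v \<psi> t);
          d\<Psi> = vector_derivative \<Psi> (at \<theta>);
          p = postsel_prob F (\<psi> \<theta>)
      in 4 / p * Re (braket d\<Psi> d\<Psi>) - 4 / p\<^sup>2 * (cmod (braket d\<Psi> (\<Psi> \<theta>)))\<^sup>2)"

definition efficiency :: "complex ^ 'n ^ 'n \<Rightarrow> (real \<Rightarrow> complex ^ 'n) \<Rightarrow> real \<Rightarrow> real" where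
  "efficiency F \<psi> \<theta> = postsel_prob F (\<psi> \<theta>) * postsel_qfi F \<psi> \<theta>"

definition weak_value :: "complex ^ 'n ^ 'n \<Rightarrow> complex ^ 'n \<Rightarrow> complex ^ 'n \<Rightarrow> complex" where
  "weak_value A \<psi> f = braket \<psi> (A *v f) / braket \<psi> f"

definition op_norm :: "complex ^ 'n ^ 'n \<Rightarrow> real" where
  "op_norm X = (SUP v \<in> {v. braket v v = 1}. Re (braket v (X *v v)))"

text \<open>A protocol is tuned by a real parameter \<open>\<phi>\<close>: the initial state is \<open>\<psi>i \<phi>\<close> and the evolved
  state at parameter value \<open>\<theta>\<close> is \<open>\<psi> \<phi> \<theta>\<close>. The two predicates below express that the respective
  condition is attained as \<open>\<phi>\<close> moves along the filter \<open>G\<close>; \<open>N\<close> is the set of vectors of the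
  postselection basis not included in \<open>F\<close>. Their weak values are required to be defined, since
  division by zero would otherwise produce the value zero.\<close>

definition optimal_advantage_limit ::
  "complex ^ 'n ^ 'n \<Rightarrow> (complex ^ 'n) set \<Rightarrow> (real \<Rightarrow> complex ^ 'n) \<Rightarrow>
     (real \<Rightarrow> real \<Rightarrow> complex ^ 'n) \<Rightarrow> real \<Rightarrow> real filter \<Rightarrow> bool" where
  "optimal_advantage_limit A N \<psi>i \<psi> \<theta> G \<longleftrightarrow>
     ((\<lambda>\<phi>. braket (\<psi>i \<phi>) (A *v \<psi>i \<phi>)) \<longlongrightarrow> 0) G \<and>
     (\<forall>f\<in>N. (\<forall>\<^sub>F \<phi> in G. braket (\<psi> \<phi> \<theta>) f \<noteq> 0) \<and>
            ((\<lambda>\<phi>. weak_value A (\<psi> \<phi> \<theta>) f) \<longlongrightarrow> 0) G)"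

definition information_preserving_limit ::
  "complex ^ 'n ^ 'n \<Rightarrow> complex ^ 'n ^ 'n \<Rightarrow> (complex ^ 'n) set \<Rightarrow> (real \<Rightarrow> complex ^ 'n) \<Rightarrow>
     (real \<Rightarrow> real \<Rightarrow> complex ^ 'n) \<Rightarrow> real \<Rightarrow> real filter \<Rightarrow> bool" where
  "information_preserving_limit A F N \<psi>i \<psi> \<theta> G \<longleftrightarrow>
     optimal_advantage_limit A N \<psi>i \<psi> \<theta> G \<and>
     ((\<lambda>\<phi>. efficiency F (\<psi> \<phi>) \<theta>) \<longlongrightarrow> 4 * op_norm (A ** A)) G"

end

theory Submission
  imports Defs
begin

text \<open>In the eigenbasis the evolved state is
  \<open>(cis x \<cdot> vp + cis (- x) \<cdot> vm) / \<surd>2\<close> with the single phase \<open>x = \<phi> - l (t - \<theta>0)\<close>, so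
  postselection leaves \<open>i sin x \<cdot> f1 + cos \<alpha> cos x \<cdot> f2\<close> and every quantity is a trigonometric
  expression in \<open>x\<close>. The vector \<open>f3\<close> has equal components along \<open>vp\<close> and \<open>vm\<close>, so its weak value is
  \<open>- i l tan x\<close>, which vanishes in the limit \<open>x \<rightarrow> 0\<close>.\<close>

section \<open>Sesquilinear algebra of the inner product\<close>

lemma braket_add_left: "braket (x + y) z = braket x z + braket y z"
  by (simp add: braket_def algebra_simps sum.distrib)

lemma braket_add_right: "braket x (y + z) = braket x y + braket x z"
  by (simp add: braket_def algebra_simps sum.distrib)

lemma braket_diff_left: "braket (x - y) z = braket x z - braket y z"
  by (simp add: braket_def algebra_simps sum_subtractf)

lemma braket_diff_right: "braket x (y - z) = braket x y - braket x z"
  by (simp add: braket_def algebra_simps sum_subtractf)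

lemma braket_scale_left: "braket (c *s x) y = cnj c * braket x y"
  by (simp add: braket_def sum_distrib_left algebra_simps)

lemma braket_scale_right: "braket x (c *s y) = c * braket x y"
  by (simp add: braket_def sum_distrib_left algebra_simps)

lemma braket_zero_right [simp]: "braket x 0 = 0"
  by (simp add: braket_def)

lemmas braket_linear = braket_add_left braket_add_right braket_diff_left braket_diff_right
  braket_scale_left braket_scale_right

lemma braket_commute: "braket y x = cnj (braket x y)"
  by (simp add: braket_def mult.commute)

lemma braket_adjoint: "braket x (adjoint_mat X *v y) = braket (X *v x) y"
  unfolding braket_def adjoint_mat_def matrix_vector_mult_def
  by (simp add: sum_distrib_left sum_distrib_right, subst sum.swap) (simp add: ac_simps)

text \<open>Turns the real scalings of the state vectors into complex ones, so that
  \<open>braket_linear\<close> applies.\<close>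

lemma scaleR_eq_vector_scale: "r *\<^sub>R x = complex_of_real r *s x"
  by (simp add: vec_eq_iff scaleR_conv_of_real[where 'a = complex])

lemma projector_mult_vec: "projector f *v x = braket f x *s f"
  by (simp add: projector_def braket_def matrix_vector_mult_def vec_eq_iff
      sum_distrib_left ac_simps)

lemma matrix_vector_scale: "(X :: complex^'n^'n) *v (c *s x) = c *s (X *v x)"
  by (simp add: matrix_vector_mult_def vec_eq_iff sum_distrib_left ac_simps)

section \<open>Expansion in orthonormal bases\<close>

lemma orthonormal_expansion:
  fixes v :: "'n::finite \<Rightarrow> complex ^ 'n"
  assumes "\<And>i j. braket (v i) (v j) = (if i = j then 1 else 0)"
  shows "x = (\<Sum>i\<in>UNIV. braket (v i) x *s v i)"
proof -
  define V :: "complex^'n^'n" where "V = (\<chi> i j. cnj (v i $ j))"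
  define W :: "complex^'n^'n" where "W = (\<chi> i j. v j $ i)"
  have "V ** W = mat 1"
    using assms by (simp add: V_def W_def matrix_matrix_mult_def mat_def vec_eq_iff braket_def)
  \<comment> \<open>Orthonormality gives a one-sided inverse; for square matrices it is two-sided,
    and \<open>W ** V = mat 1\<close> is the completeness relation.\<close>
  then have "W ** V = mat 1"
    by (simp add: matrix_left_right_inverse)
  then have "x = W *v (V *v x)"
    by (simp add: matrix_vector_mul_assoc)
  also have "V *v x = (\<chi> i. braket (v i) x)"
    by (simp add: V_def braket_def matrix_vector_mult_def vec_eq_iff)
  also have "W *v \<dots> = (\<Sum>i\<in>UNIV. braket (v i) x *s v i)"
    by (simp add: W_def matrix_vector_mult_def vec_eq_iff ac_simps)
  finally show ?thesis .
qed

lemma orthonormal3_expansion: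
  fixes u v w :: "complex ^ 3"
  assumes "orthonormal [u, v, w]"
  shows "x = braket u x *s u + braket v x *s v + braket w x *s w"
proof -
  define e :: "3 \<Rightarrow> complex ^ 3" where "e = (\<lambda>i. if i = 1 then u else if i = 2 then v else w)"
  have "\<forall>i j. braket (e i) (e j) = (if i = j then 1 else 0)"
    using assms by (simp add: orthonormal_def e_def forall_3 All_less_Suc numeral_3_eq_3)
  from orthonormal_expansion[of e x] this show ?thesis
    by (simp add: sum_3 e_def)
qed

text \<open>Parseval's identity: \<open>y\<close> is expanded in the basis, and the conjugates come
  from reading the coordinates of \<open>x\<close> in the reverse order.\<close>

lemma orthonormal3_braket:
  fixes u v w :: "complex ^ 3"
  assumes "orthonormal [u, v, w]"
  shows "braket x y = cnj (braket u x) * braket u y + cnj (braket v x) * braket v y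
    + cnj (braket w x) * braket w y"
  by (subst orthonormal3_expansion[OF assms, of y])
     (simp add: braket_linear braket_commute[of x] mult.commute)

lemma orthonormal3_simps:
  assumes "orthonormal [u, v, w]"
  shows "braket u u = 1" "braket v v = 1" "braket w w = 1"
    "braket u v = 0" "braket v u = 0" "braket u w = 0" "braket w u = 0"
    "braket v w = 0" "braket w v = 0"
  using assms by (simp_all add: orthonormal_def All_less_Suc numeral_3_eq_3)

section \<open>The matrix exponential and its action on eigenvectors\<close>

lemma bounded_bilinear_matrix_mult:
  "bounded_bilinear ((**) :: complex^'n^'n \<Rightarrow> complex^'n^'n \<Rightarrow> complex^'n^'n)"
proof -
  have "bilinear ((**) :: complex^'n^'n \<Rightarrow> complex^'n^'n \<Rightarrow> complex^'n^'n)"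
    unfolding bilinear_def
    by (auto intro!: linearI simp: matrix_matrix_mult_def vec_eq_iff algebra_simps
        sum.distrib scaleR_sum_right)
  then show ?thesis
    by (simp add: bilinear_conv_bounded_bilinear)
qed

text \<open>Matrix multiplication is bounded bilinear, hence submultiplicative up to a factor
  \<open>K\<close>, so the terms are dominated by the real exponential series at
  \<open>norm X * K\<close> times the norm of the identity.\<close>

lemma summable_mat_exp:
  fixes X :: "complex^'n^'n"
  shows "summable (\<lambda>k. (1 / fact k) *\<^sub>R (((**) X) ^^ k) (mat 1))"
proof -
  obtain K where K: "K \<ge> 0" "\<And>Y Z. norm (Y ** Z :: complex^'n^'n) \<le> norm (Y :: complex^'n^'n) * norm Z * K"
    using bounded_bilinear.nonneg_bounded[OF bounded_bilinear_matrix_mult] by blast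
  have bound: "norm ((((**) X) ^^ k) (mat 1)) \<le> (norm X * K) ^ k * norm (mat 1 :: complex^'n^'n)"
    for k
  proof (induction k)
    case (Suc k)
    have "norm ((((**) X) ^^ Suc k) (mat 1)) \<le> norm X * norm ((((**) X) ^^ k) (mat 1)) * K"
      using K(2)[of X "(((**) X) ^^ k) (mat 1)"] by simp
    also have "\<dots> \<le> norm X * ((norm X * K) ^ k * norm (mat 1 :: complex^'n^'n)) * K"
      by (intro mult_right_mono[OF mult_left_mono[OF Suc]] K(1) norm_ge_zero)
    finally show ?case by (simp add: ac_simps)
  qed simp
  have "summable (\<lambda>k. (norm X * K) ^ k /\<^sub>R fact k * norm (mat 1 :: complex^'n^'n))"
    using summable_exp_generic by (rule summable_mult2)
  moreover have "norm ((1 / fact k) *\<^sub>R (((**) X) ^^ k) (mat 1))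
      \<le> (norm X * K) ^ k /\<^sub>R fact k * norm (mat 1 :: complex^'n^'n)" for k
    using mult_left_mono[OF bound, of "1 / fact k" k] by (simp add: field_simps)
  ultimately show ?thesis
    by (rule summable_comparison_test'[where N = 0])
qed

text \<open>Evaluation at \<open>v\<close> is a bounded linear map on matrices, so it passes through
  the series; each power of \<open>X\<close> then acts as \<open>c ^ k\<close>, leaving the scalar
  exponential series.\<close>

lemma mat_exp_eigenvector:
  fixes X :: "complex^'n^'n"
  assumes "X *v v = c *s v"
  shows "mat_exp X *v v = exp c *s v"
proof -
  have pow: "(((**) X) ^^ k) (mat 1) *v v = c ^ k *s v" for k
    by (induction k) (simp_all add: matrix_vector_mul_assoc[symmetric] matrix_vector_scale assms
        vector_smult_assoc mult.commute)
  have "linear (\<lambda>Y :: complex^'n^'n. Y *v v)"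
    by (auto intro!: linearI simp: matrix_vector_mult_def vec_eq_iff algebra_simps sum.distrib
        scaleR_sum_right)
  then have "bounded_linear (\<lambda>Y :: complex^'n^'n. Y *v v)"
    by (simp add: linear_conv_bounded_linear)
  from bounded_linear.sums[OF this summable_sums[OF summable_mat_exp[of X]]]
  have "(\<lambda>k. ((1 / fact k) *\<^sub>R (((**) X) ^^ k) (mat 1)) *v v) sums (mat_exp X *v v)"
    by (simp add: mat_exp_def)
  also have "(\<lambda>k. ((1 / fact k) *\<^sub>R (((**) X) ^^ k) (mat 1)) *v v) = (\<lambda>k. (c ^ k /\<^sub>R fact k) *s v)"
  proof
    fix k
    have "((1 / fact k) *\<^sub>R (((**) X) ^^ k) (mat 1)) *v v
        = (1 / fact k) *\<^sub>R ((((**) X) ^^ k) (mat 1) *v v)"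
      by (simp add: matrix_vector_mult_def vec_eq_iff scaleR_sum_right)
    then show "((1 / fact k) *\<^sub>R (((**) X) ^^ k) (mat 1)) *v v = (c ^ k /\<^sub>R fact k) *s v"
      by (simp add: pow vec_eq_iff divide_inverse)
  qed
  finally have "(\<lambda>k. (c ^ k /\<^sub>R fact k) *s v) sums (mat_exp X *v v)" .
  moreover have "(\<lambda>k. (c ^ k /\<^sub>R fact k) *s v) sums (exp c *s v)"
  proof -
    have "linear (\<lambda>z :: complex. z *s v)"
      by (auto intro!: linearI simp: vec_eq_iff algebra_simps)
    then have "bounded_linear (\<lambda>z :: complex. z *s v)"
      by (simp add: linear_conv_bounded_linear)
    from bounded_linear.sums[OF this exp_converges[of c]] show ?thesis .
  qed
  ultimately show ?thesis by (rule sums_unique2)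
qed

lemma evolution_eigenvector:
  assumes "A *v v = of_real l *s v"
  shows "evolution A t *v v = cis (- (l * t)) *s v"
proof -
  have "(\<chi> i j. - \<i> * of_real t * A $ i $ j) *v v = (- \<i> * of_real t) *s (A *v v)"
    by (simp add: matrix_vector_mult_def vec_eq_iff sum_distrib_left sum_negf ac_simps)
  then have "(\<chi> i j. - \<i> * of_real t * A $ i $ j) *v v = (- \<i> * of_real t * of_real l) *s v"
    by (simp add: assms)
  from mat_exp_eigenvector[OF this] show ?thesis
    by (simp add: evolution_def cis_conv_exp ac_simps)
qed

section \<open>Operators diagonal in an orthonormal basis\<close>

lemma adjoint_eigenvectors:
  fixes u v w :: "complex ^ 3"
  assumes on: "orthonormal [u, v, w]"
    and eig: "X *v u = a *s u" "X *v v = b *s v" "X *v w = c *s w"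
  shows "adjoint_mat X *v u = cnj a *s u" "adjoint_mat X *v v = cnj b *s v"
    "adjoint_mat X *v w = cnj c *s w"
  \<comment> \<open>The coordinate of \<open>adjoint_mat X *v y\<close> along a basis vector
    \<open>e\<close> is \<open>braket (X *v e) y\<close>: the eigenvalue leaves the bra conjugated,
    and only the diagonal coordinate survives.\<close>
  by (subst orthonormal3_expansion[OF on, of "adjoint_mat X *v _"],
      simp add: braket_adjoint eig braket_linear orthonormal3_simps[OF on])+

text \<open>In a unit vector the expectation of \<open>A ** A\<close> is a mean of the squared
  eigenvalues, weighted by the squared moduli of the coordinates, so it is at most the largest one;
  \<open>u\<close> attains it.\<close>

lemma op_norm_square_eq:
  fixes u v w :: "complex ^ 3"
  assumes on: "orthonormal [u, v, w]" and sa: "adjoint_mat A = A"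
    and eig: "A *v u = of_real a *s u" "A *v v = of_real b *s v" "A *v w = of_real c *s w"
    and le: "b\<^sup>2 \<le> a\<^sup>2" "c\<^sup>2 \<le> a\<^sup>2"
  shows "op_norm (A ** A) = a\<^sup>2"
proof -
  have move: "braket x (A *v y) = braket (A *v x) y" for x y
    using braket_adjoint[of x A y] sa by simp
  have exp: "Re (braket x ((A ** A) *v x)) = a\<^sup>2 * (cmod (braket u x))\<^sup>2
      + b\<^sup>2 * (cmod (braket v x))\<^sup>2 + c\<^sup>2 * (cmod (braket w x))\<^sup>2" for x
    by (subst orthonormal3_braket[OF on])
       (simp add: matrix_vector_mul_assoc[symmetric] move eig braket_linear matrix_vector_scale
        cmod_power2, simp add: power2_eq_square algebra_simps)
  have "Re (braket x x) = (cmod (braket u x))\<^sup>2 + (cmod (braket v x))\<^sup>2 + (cmod (braket w x))\<^sup>2" for x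
    by (subst orthonormal3_braket[OF on]) (simp add: cmod_power2, simp add: power2_eq_square)
  then have unit: "(cmod (braket u x))\<^sup>2 + (cmod (braket v x))\<^sup>2 + (cmod (braket w x))\<^sup>2 = 1"
    if "braket x x = 1" for x
    using that by (metis one_complex.sel(1))
  show ?thesis
    unfolding op_norm_def
  proof (rule cSup_eq_maximum)
    have "Re (braket u ((A ** A) *v u)) = a\<^sup>2"
      by (simp add: exp orthonormal3_simps[OF on])
    then show "a\<^sup>2 \<in> (\<lambda>x. Re (braket x ((A ** A) *v x))) ` {x. braket x x = 1}"
      using orthonormal3_simps(1)[OF on] by (auto intro!: image_eqI[of _ _ u])
  next
    fix r assume "r \<in> (\<lambda>x. Re (braket x ((A ** A) *v x))) ` {x. braket x x = 1}"
    then obtain x where x: "braket x x = 1" and r: "r = Re (braket x ((A ** A) *v x))" by auto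
    have "r \<le> a\<^sup>2 * (cmod (braket u x))\<^sup>2 + a\<^sup>2 * (cmod (braket v x))\<^sup>2 + a\<^sup>2 * (cmod (braket w x))\<^sup>2"
      unfolding r exp by (intro add_mono mult_right_mono le) auto
    also have "\<dots> = a\<^sup>2 * ((cmod (braket u x))\<^sup>2 + (cmod (braket v x))\<^sup>2 + (cmod (braket w x))\<^sup>2)"
      by (simp add: algebra_simps)
    finally show "r \<le> a\<^sup>2" by (simp add: unit[OF x])
  qed
qed

theorem mainTheorem3:
  fixes A F :: "complex ^ 3 ^ 3"
    and vp vt vm f1 f2 f3 :: "complex ^ 3"
    and \<psi>i :: "real \<Rightarrow> complex ^ 3"
    and \<psi> :: "real \<Rightarrow> real \<Rightarrow> complex ^ 3"
    and l lt \<alpha> \<theta> \<theta>0 \<delta> :: real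
  assumes observable: "adjoint_mat A = A"
    and eigenbasis: "orthonormal [vp, vt, vm]"
    and eigen_vp: "A *v vp = of_real l *s vp"
    and eigen_vt: "A *v vt = of_real lt *s vt"
    and eigen_vm: "A *v vm = of_real (- l) *s vm"
    and nondegenerate: "distinct [l, lt, - l]"
    and delta: "\<delta> = \<theta> - \<theta>0"
    and f1: "f1 = (1 / sqrt 2) *\<^sub>R (vp - vm)"
    and f2: "f2 = (1 / sqrt 2) *\<^sub>R (cos \<alpha> *\<^sub>R vp + cos \<alpha> *\<^sub>R vm) + sin \<alpha> *\<^sub>R vt"
    and f3: "orthonormal [f1, f2, f3]"
    and F: "F = projector f1 + projector f2"
    and psi_i: "\<And>\<phi>. \<psi>i \<phi> = (1 / sqrt 2) *\<^sub>R (adjoint_mat (evolution A \<theta>0) *v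
             ((of_real (cos \<phi>) + \<i> * of_real (sin \<phi>)) *s vp
            + (of_real (cos \<phi>) - \<i> * of_real (sin \<phi>)) *s vm))"
    and psi: "\<And>\<phi> t. \<psi> \<phi> t = evolution A t *v \<psi>i \<phi>"
  shows "(\<forall>\<phi>. postsel_prob F (\<psi> \<phi> \<theta>) =
             (sin (\<phi> - l * \<delta>))\<^sup>2 + (cos \<alpha>)\<^sup>2 * (cos (\<phi> - l * \<delta>))\<^sup>2) \<and>
         (\<forall>\<phi>. postsel_prob F (\<psi> \<phi> \<theta>) \<noteq> 0 \<longrightarrow>
             efficiency F (\<psi> \<phi>) \<theta> =
               4 * l\<^sup>2 * (cos \<alpha>)\<^sup>2 /
               ((sin (\<phi> - l * \<delta>))\<^sup>2 + (cos \<alpha>)\<^sup>2 * (cos (\<phi> - l * \<delta>))\<^sup>2)) \<and>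
         (\<forall>\<phi>. sin (\<phi> - l * \<delta>) \<noteq> 0 \<longrightarrow>
             braket (\<psi> \<phi> \<theta>) f1 \<noteq> 0 \<and>
             weak_value A (\<psi> \<phi> \<theta>) f1 =
               \<i> * of_real (l * cos (\<phi> - l * \<delta>)) / of_real (sin (\<phi> - l * \<delta>))) \<and>
         (\<forall>\<phi>. cos \<alpha> \<noteq> 0 \<and> cos (\<phi> - l * \<delta>) \<noteq> 0 \<longrightarrow>
             braket (\<psi> \<phi> \<theta>) f2 \<noteq> 0 \<and>
             weak_value A (\<psi> \<phi> \<theta>) f2 =
               - \<i> * of_real (l * sin (\<phi> - l * \<delta>)) / of_real (cos (\<phi> - l * \<delta>))) \<and>
         (sin \<alpha> \<noteq> 0 \<longrightarrow> optimal_advantage_limit A {f3} \<psi>i \<psi> \<theta> (at (l * \<delta>))) \<and>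
         (((\<lambda>\<phi>. postsel_prob F (\<psi> \<phi> \<theta>)) \<longlongrightarrow> (cos \<alpha>)\<^sup>2) (at (l * \<delta>))) \<and>
         (cos \<alpha> \<noteq> 0 \<longrightarrow>
             ((\<lambda>\<phi>. postsel_qfi F (\<psi> \<phi>) \<theta>) \<longlongrightarrow> 4 * l\<^sup>2 * (1 / cos \<alpha>)\<^sup>2) (at (l * \<delta>))) \<and>
         (cos \<alpha> \<noteq> 0 \<longrightarrow>
             ((\<lambda>\<phi>. efficiency F (\<psi> \<phi>) \<theta>) \<longlongrightarrow> 4 * l\<^sup>2) (at (l * \<delta>))) \<and>
         (cos \<alpha> \<noteq> 0 \<and> sin \<alpha> \<noteq> 0 \<and> \<bar>lt\<bar> \<le> \<bar>l\<bar> \<longrightarrow>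
             information_preserving_limit A F {f3} \<psi>i \<psi> \<theta> (at (l * \<delta>)))"
proof -

  \<comment> \<open>The evolved state in the eigenbasis\<close>
  define c where "c = complex_of_real (1 / sqrt 2)"
  define x where "x = (\<lambda>\<phi> t. \<phi> - l * (t - \<theta>0))"
  \<comment> \<open>An overlap collects one factor \<open>1 / sqrt 2\<close> from the state and one
    from \<open>f1\<close> or \<open>f2\<close>; \<open>cc\<close> merges the two.\<close>
  have cc: "c * (c * z) = z / 2" and cnj_c: "cnj c = c" for z
    by (simp_all add: c_def mult.assoc[symmetric] of_real_mult[symmetric] del: of_real_mult)
  have c0: "c \<noteq> 0" by (simp add: c_def)
  note on = orthonormal3_simps[OF eigenbasis]
  note onf = orthonormal3_simps[OF f3]
  have A_sym: "braket y (A *v z) = braket (A *v y) z" for y z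
    using braket_adjoint[of y A z] observable by simp
  have cis_sum: "cis (- r) + cis r = 2 * of_real (cos r)"
    and cis_diff: "cis (- r) - cis r = - 2 * \<i> * of_real (sin r)" for r
    by (simp_all add: complex_eq_iff)

  have f1': "f1 = c *s (vp - vm)"
    by (simp add: f1 scaleR_eq_vector_scale c_def)
  have f2': "f2 = c *s (of_real (cos \<alpha>) *s vp + of_real (cos \<alpha>) *s vm) + of_real (sin \<alpha>) *s vt"
    by (simp add: f2 scaleR_eq_vector_scale c_def)

  \<comment> \<open>The adjoint of \<open>evolution A \<theta>0\<close> multiplies \<open>vp\<close>
    by \<open>cis (l * \<theta>0)\<close> and \<open>vm\<close> by the inverse, so preparation only
    shifts the phase.\<close>
  have psi_i': "\<psi>i \<phi> = c *s (cis (\<phi> + l * \<theta>0) *s vp + cis (- (\<phi> + l * \<theta>0)) *s vm)" for \<phi>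
  proof -
    have e: "of_real (cos \<phi>) + \<i> * of_real (sin \<phi>) = cis \<phi>"
      "of_real (cos \<phi>) - \<i> * of_real (sin \<phi>) = cis (- \<phi>)"
      by (simp_all add: complex_eq_iff)
    show ?thesis
      unfolding psi_i e
        matrix_vector_right_distrib matrix_vector_scale
        adjoint_eigenvectors[OF eigenbasis evolution_eigenvector[OF eigen_vp]
          evolution_eigenvector[OF eigen_vt] evolution_eigenvector[OF eigen_vm]]
      by (simp add: scaleR_eq_vector_scale c_def vector_smult_assoc cis_cnj cis_mult add.commute)
  qed
  have psi': "\<psi> \<phi> t = c *s (cis (x \<phi> t) *s vp + cis (- x \<phi> t) *s vm)" for \<phi> t
    unfolding psi psi_i' matrix_vector_right_distrib matrix_vector_scale
      evolution_eigenvector[OF eigen_vp] evolution_eigenvector[OF eigen_vm]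
    by (simp add: vector_smult_assoc cis_mult x_def algebra_simps)
  \<comment> \<open>Conjugation in the bra exchanges the two signs: \<open>vp\<close> now carries
    the phase \<open>- x\<close>.\<close>
  have psi_braket: "braket (\<psi> \<phi> t) y
      = c * (cis (- x \<phi> t) * braket vp y + cis (x \<phi> t) * braket vm y)" for \<phi> t y
    by (simp add: psi' braket_linear cnj_c cis_cnj distrib_left)
  \<comment> \<open>\<open>A\<close> is moved onto the state, where its opposite eigenvalues turn
    the sum of the two terms into a difference. This exchanges sine and cosine between the overlaps
    with and without \<open>A\<close>.\<close>
  have psi_A_braket: "braket (\<psi> \<phi> t) (A *v y)
      = of_real l * c * (cis (- x \<phi> t) * braket vp y - cis (x \<phi> t) * braket vm y)" for \<phi> t y
    unfolding A_sym psi' matrix_vector_right_distrib matrix_vector_scale eigen_vp eigen_vm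
    by (simp add: braket_linear cnj_c cis_cnj algebra_simps)

  \<comment> \<open>Overlaps with the postselected vectors\<close>
  have f1_braket: "braket vp f1 = c" "braket vm f1 = - c"
    by (simp_all add: f1' braket_linear on)
  have f2_braket: "braket vp f2 = c * of_real (cos \<alpha>)" "braket vm f2 = c * of_real (cos \<alpha>)"
    by (simp_all add: f2' braket_linear on)
  have psi_f1: "braket (\<psi> \<phi> t) f1 = - \<i> * of_real (sin (x \<phi> t))" for \<phi> t
  proof -
    have "braket (\<psi> \<phi> t) f1 = c * (c * (cis (- x \<phi> t) - cis (x \<phi> t)))"
      by (simp add: psi_braket f1_braket algebra_simps)
    then show ?thesis unfolding cc cis_diff by simp
  qed
  have psi_f2: "braket (\<psi> \<phi> t) f2 = of_real (cos \<alpha> * cos (x \<phi> t))" for \<phi> t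
  proof -
    have "braket (\<psi> \<phi> t) f2 = c * (c * (of_real (cos \<alpha>) * (cis (- x \<phi> t) + cis (x \<phi> t))))"
      by (simp add: psi_braket f2_braket algebra_simps)
    then show ?thesis unfolding cc cis_sum by simp
  qed
  have psi_A_f1: "braket (\<psi> \<phi> t) (A *v f1) = of_real (l * cos (x \<phi> t))" for \<phi> t
  proof -
    have "braket (\<psi> \<phi> t) (A *v f1) = c * (c * (of_real l * (cis (- x \<phi> t) + cis (x \<phi> t))))"
      by (simp add: psi_A_braket f1_braket algebra_simps)
    then show ?thesis unfolding cc cis_sum by simp
  qed
  have psi_A_f2: "braket (\<psi> \<phi> t) (A *v f2) = - \<i> * of_real (l * cos \<alpha> * sin (x \<phi> t))" for \<phi> t
  proof -
    have "braket (\<psi> \<phi> t) (A *v f2)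
        = c * (c * (of_real (l * cos \<alpha>) * (cis (- x \<phi> t) - cis (x \<phi> t))))"
      by (simp add: psi_A_braket f2_braket algebra_simps)
    then show ?thesis unfolding cc cis_diff by simp
  qed

  \<comment> \<open>The postselected state and its derivative\<close>
  have F_vec: "F *v y = braket f1 y *s f1 + braket f2 y *s f2" for y
    by (simp add: F matrix_vector_mult_add_rdistrib projector_mult_vec)
  \<comment> \<open>With \<open>\<i>\<close> absorbed into the first vector both coefficients are
    real, so each is differentiated as a real function of \<open>t\<close>.\<close>
  have Psi: "F *v \<psi> \<phi> t = sin (x \<phi> t) *\<^sub>R (\<i> *s f1) + (cos \<alpha> * cos (x \<phi> t)) *\<^sub>R f2" for \<phi> t
    unfolding F_vec braket_commute[of f1 "\<psi> \<phi> t"] braket_commute[of f2 "\<psi> \<phi> t"] psi_f1 psi_f2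
    by (simp add: scaleR_eq_vector_scale vector_smult_assoc mult.commute)
  \<comment> \<open>The phase has derivative \<open>- l\<close> in \<open>t\<close>, which fixes
    both signs.\<close>
  define d\<Psi> where "d\<Psi> = (\<lambda>\<phi>. (- l * cos (x \<phi> \<theta>)) *\<^sub>R (\<i> *s f1)
    + (l * cos \<alpha> * sin (x \<phi> \<theta>)) *\<^sub>R f2)"
  have dPsi: "vector_derivative (\<lambda>t. F *v \<psi> \<phi> t) (at \<theta>) = d\<Psi> \<phi>" for \<phi>
  proof (rule vector_derivative_at)
    have "((\<lambda>t. sin (x \<phi> t)) has_field_derivative - l * cos (x \<phi> \<theta>)) (at \<theta>)"
      "((\<lambda>t. cos \<alpha> * cos (x \<phi> t)) has_field_derivative l * cos \<alpha> * sin (x \<phi> \<theta>)) (at \<theta>)"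
      unfolding x_def by (auto intro!: derivative_eq_intros)
    from has_vector_derivative_add[OF
        has_vector_derivative_scaleR[OF this(1) has_vector_derivative_const[of "\<i> *s f1"]]
        has_vector_derivative_scaleR[OF this(2) has_vector_derivative_const[of f2]]]
    show "((\<lambda>t. F *v \<psi> \<phi> t) has_vector_derivative d\<Psi> \<phi>) (at \<theta>)"
      by (simp add: Psi d\<Psi>_def)
  qed

  \<comment> \<open>Probability, Fisher information and efficiency\<close>
  define S where "S = (\<lambda>\<phi>. sin (\<phi> - l * \<delta>))"
  define C where "C = (\<lambda>\<phi>. cos (\<phi> - l * \<delta>))"
  define a where "a = cos \<alpha>"
  have S_x: "sin (x \<phi> \<theta>) = S \<phi>" and C_x: "cos (x \<phi> \<theta>) = C \<phi>" for \<phi>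
    by (simp_all add: S_def C_def x_def delta)
  have SC: "(C \<phi>)\<^sup>2 = 1 - (S \<phi>)\<^sup>2" for \<phi>
    by (simp add: S_def C_def cos_squared_eq)
  define p where "p = (\<lambda>\<phi>. (S \<phi>)\<^sup>2 + a\<^sup>2 * (C \<phi>)\<^sup>2)"
  have prob: "postsel_prob F (\<psi> \<phi> \<theta>) = p \<phi>" for \<phi>
    unfolding postsel_prob_def Psi
    by (simp add: braket_linear scaleR_eq_vector_scale psi_f1 psi_f2 p_def S_x C_x a_def
        power2_eq_square)
  have dd: "braket (d\<Psi> \<phi>) (d\<Psi> \<phi>) = of_real (l\<^sup>2 * ((C \<phi>)\<^sup>2 + a\<^sup>2 * (S \<phi>)\<^sup>2))" for \<phi>
    unfolding d\<Psi>_def scaleR_eq_vector_scale S_x C_x a_def[symmetric]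
    by (simp add: braket_linear onf power2_eq_square algebra_simps)
  \<comment> \<open>Real coordinates relative to \<open>\<i> *s f1\<close> and \<open>f2\<close>
    make this inner product real, so its squared modulus in the Fisher information is an ordinary
    square.\<close>
  have dP: "braket (d\<Psi> \<phi>) (F *v \<psi> \<phi> \<theta>) = of_real (l * S \<phi> * C \<phi> * (a\<^sup>2 - 1))" for \<phi>
    unfolding d\<Psi>_def Psi scaleR_eq_vector_scale S_x C_x a_def[symmetric]
    by (simp add: braket_linear onf power2_eq_square algebra_simps)
  have qfi: "postsel_qfi F (\<psi> \<phi>) \<theta> = 4 / p \<phi> * (l\<^sup>2 * ((C \<phi>)\<^sup>2 + a\<^sup>2 * (S \<phi>)\<^sup>2))
      - 4 / (p \<phi>)\<^sup>2 * (l * S \<phi> * C \<phi> * (a\<^sup>2 - 1))\<^sup>2" for \<phi>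
    unfolding postsel_qfi_def Let_def dPsi dd dP prob norm_of_real by simp
  have eff: "efficiency F (\<psi> \<phi>) \<theta> = 4 * l\<^sup>2 * a\<^sup>2 / p \<phi>" if "p \<phi> \<noteq> 0" for \<phi>
  proof -
    \<comment> \<open>The left side is the Gram determinant of the postselected state and its
      derivative. By Lagrange's identity it is the square of the determinant of their real
      coordinates, which is \<open>l * a\<close> since the squares of sine and cosine sum to
      1.\<close>
    have "p \<phi> * (l\<^sup>2 * ((C \<phi>)\<^sup>2 + a\<^sup>2 * (S \<phi>)\<^sup>2)) - (l * S \<phi> * C \<phi> * (a\<^sup>2 - 1))\<^sup>2 = l\<^sup>2 * a\<^sup>2"
      unfolding p_def power_mult_distrib SC by algebra
    moreover have "efficiency F (\<psi> \<phi>) \<theta> = 4 *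
        (p \<phi> * (l\<^sup>2 * ((C \<phi>)\<^sup>2 + a\<^sup>2 * (S \<phi>)\<^sup>2)) - (l * S \<phi> * C \<phi> * (a\<^sup>2 - 1))\<^sup>2) / p \<phi>"
      unfolding efficiency_def prob qfi using that by (simp add: field_simps power2_eq_square)
    ultimately show ?thesis by simp
  qed
  \<comment> \<open>Sine and cosine do not vanish together. As this covers every
    \<open>\<phi>\<close>, the closed form \<open>eff\<close> can be substituted under the
    limits.\<close>
  have p_nz: "p \<phi> \<noteq> 0" if "a \<noteq> 0" for \<phi>
  proof
    assume "p \<phi> = 0"
    then have "(S \<phi>)\<^sup>2 = 0" "a\<^sup>2 * (C \<phi>)\<^sup>2 = 0"
      unfolding p_def by (simp_all add: add_nonneg_eq_0_iff)
    with that SC[of \<phi>] show False by simp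
  qed

  \<comment> \<open>Limits as the phase vanishes\<close>
  have S_lim: "(S \<longlongrightarrow> 0) (at (l * \<delta>))"
  proof -
    have "(S \<longlongrightarrow> sin (l * \<delta> - l * \<delta>)) (at (l * \<delta>))"
      unfolding S_def by (intro tendsto_intros)
    then show ?thesis by simp
  qed
  have C_lim: "(C \<longlongrightarrow> 1) (at (l * \<delta>))"
  proof -
    have "(C \<longlongrightarrow> cos (l * \<delta> - l * \<delta>)) (at (l * \<delta>))"
      unfolding C_def by (intro tendsto_intros)
    then show ?thesis by simp
  qed
  have p_lim: "(p \<longlongrightarrow> a\<^sup>2) (at (l * \<delta>))"
    unfolding p_def by (rule tendsto_eq_intros S_lim C_lim refl)+ simp
  have eff_lim: "((\<lambda>\<phi>. efficiency F (\<psi> \<phi>) \<theta>) \<longlongrightarrow> 4 * l\<^sup>2) (at (l * \<delta>))" if "a \<noteq> 0"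
  proof -
    have "((\<lambda>\<phi>. 4 * l\<^sup>2 * a\<^sup>2 / p \<phi>) \<longlongrightarrow> 4 * l\<^sup>2 * a\<^sup>2 / a\<^sup>2) (at (l * \<delta>))"
      using that by (intro tendsto_intros p_lim) auto
    with that show ?thesis by (simp add: eff p_nz)
  qed
  have qfi_lim: "((\<lambda>\<phi>. postsel_qfi F (\<psi> \<phi>) \<theta>) \<longlongrightarrow> 4 * l\<^sup>2 * (1 / a)\<^sup>2) (at (l * \<delta>))"
    if "a \<noteq> 0"
  proof -
    \<comment> \<open>The limit of the Fisher information becomes the quotient of the limits of the
      efficiency and of \<open>p\<close>.\<close>
    have "postsel_qfi F (\<psi> \<phi>) \<theta> = efficiency F (\<psi> \<phi>) \<theta> / p \<phi>" for \<phi>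
      using p_nz[OF that] by (simp add: efficiency_def prob)
    moreover have "((\<lambda>\<phi>. efficiency F (\<psi> \<phi>) \<theta> / p \<phi>) \<longlongrightarrow> 4 * l\<^sup>2 / a\<^sup>2) (at (l * \<delta>))"
      using that by (intro tendsto_intros p_lim eff_lim) auto
    ultimately show ?thesis by (simp add: power_divide)
  qed

  \<comment> \<open>With \<open>sin \<alpha> = 0\<close> the vectors \<open>f1\<close> and
    \<open>f2\<close> would span the plane of \<open>vp\<close> and \<open>vm\<close>, leaving
    \<open>f3\<close> orthogonal to every evolved state and its weak value undefined.\<close>
  have opt: "optimal_advantage_limit A {f3} \<psi>i \<psi> \<theta> (at (l * \<delta>))" if sin: "sin \<alpha> \<noteq> 0"
  proof -
    define b where "b = braket vp f3"
    \<comment> \<open>Orthogonality to \<open>f1\<close>, a multiple of \<open>vp - vm\<close>,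
      forces equal components.\<close>
    have "c * (braket vp f3 - braket vm f3) = 0"
      using onf(6) by (simp add: f1' braket_linear cnj_c)
    then have b_vm: "braket vm f3 = b" using c0 by (simp add: b_def)
    \<comment> \<open>If \<open>b\<close> vanished, \<open>f3\<close> would be a multiple of
      \<open>vt\<close>; orthogonality to \<open>f2\<close>, whose \<open>vt\<close> component is
      \<open>sin \<alpha>\<close>, would make it zero, against its unit norm.\<close>
    have b0: "b \<noteq> 0"
    proof
      assume "b = 0"
      moreover from this have "braket vt f3 = 0"
        using onf(8) sin b_vm by (simp add: f2' braket_linear b_def)
      ultimately have "f3 = 0"
        using orthonormal3_expansion[OF eigenbasis, of f3] b_vm by (simp add: b_def)
      then show False using onf(3) by simp
    qed
    have psi_f3: "braket (\<psi> \<phi> \<theta>) f3 = 2 * c * b * of_real (C \<phi>)" for \<phi>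
    proof -
      have "braket (\<psi> \<phi> \<theta>) f3 = c * b * (cis (- x \<phi> \<theta>) + cis (x \<phi> \<theta>))"
        by (simp add: psi_braket b_vm b_def[symmetric] algebra_simps)
      then show ?thesis unfolding cis_sum C_x by simp
    qed
    have psi_A_f3: "braket (\<psi> \<phi> \<theta>) (A *v f3) = - 2 * \<i> * c * b * of_real (l * S \<phi>)" for \<phi>
    proof -
      have "braket (\<psi> \<phi> \<theta>) (A *v f3) = of_real l * c * b * (cis (- x \<phi> \<theta>) - cis (x \<phi> \<theta>))"
        by (simp add: psi_A_braket b_vm b_def[symmetric] algebra_simps)
      then show ?thesis unfolding cis_diff S_x by simp
    qed
    have weak: "weak_value A (\<psi> \<phi> \<theta>) f3 = - \<i> * of_real (l * S \<phi>) / of_real (C \<phi>)" for \<phi>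
      unfolding weak_value_def psi_f3 psi_A_f3 using c0 b0 by simp
    have "((\<lambda>\<phi>. - \<i> * of_real (l * S \<phi>) / of_real (C \<phi>))
        \<longlongrightarrow> - \<i> * of_real (l * 0) / of_real 1) (at (l * \<delta>))"
      by (intro tendsto_intros S_lim C_lim) auto
    then have "((\<lambda>\<phi>. weak_value A (\<psi> \<phi> \<theta>) f3) \<longlongrightarrow> 0) (at (l * \<delta>))"
      by (simp add: weak)
    \<comment> \<open>The overlap with \<open>f3\<close> is a nonzero multiple of \<open>C\<close>,
      which tends to 1.\<close>
    moreover have "\<forall>\<^sub>F \<phi> in at (l * \<delta>). braket (\<psi> \<phi> \<theta>) f3 \<noteq> 0"
      using tendsto_imp_eventually_ne[OF C_lim, of 0] c0 b0 by (simp add: psi_f3)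
    \<comment> \<open>Equal weights on \<open>vp\<close> and \<open>vm\<close> and opposite
      eigenvalues make the mean vanish for every \<open>\<phi>\<close>, not only in the
      limit.\<close>
    moreover have "braket (\<psi>i \<phi>) (A *v \<psi>i \<phi>) = 0" for \<phi>
      unfolding psi_i' matrix_vector_right_distrib matrix_vector_scale eigen_vp eigen_vm
      by (simp add: braket_linear on cis_cnj cis_mult mult.left_commute[of "cis _" _ "cis _"])
    ultimately show ?thesis
      unfolding optimal_advantage_limit_def by simp
  qed

  \<comment> \<open>The bound on \<open>lt\<close> makes \<open>l\<^sup>2\<close> the largest
    eigenvalue of \<open>A ** A\<close>, so the general efficiency bound is
    \<open>4 * l\<^sup>2\<close>, the value reached in \<open>eff_lim\<close>.\<close>
  have op: "op_norm (A ** A) = l\<^sup>2" if "\<bar>lt\<bar> \<le> \<bar>l\<bar>"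
    using that by (intro op_norm_square_eq[OF eigenbasis observable eigen_vp eigen_vt eigen_vm])
      (simp_all add: abs_le_square_iff)

  have w1: "braket (\<psi> \<phi> \<theta>) f1 \<noteq> 0 \<and>
      weak_value A (\<psi> \<phi> \<theta>) f1 = \<i> * of_real (l * C \<phi>) / of_real (S \<phi>)" if "S \<phi> \<noteq> 0" for \<phi>
    using that by (simp add: weak_value_def psi_f1 psi_A_f1 S_x C_x divide_simps)
  \<comment> \<open>The factor \<open>cos \<alpha>\<close> is common to numerator and denominator
    and cancels.\<close>
  have w2: "braket (\<psi> \<phi> \<theta>) f2 \<noteq> 0 \<and>
      weak_value A (\<psi> \<phi> \<theta>) f2 = - \<i> * of_real (l * S \<phi>) / of_real (C \<phi>)"
    if "a \<noteq> 0" "C \<phi> \<noteq> 0" for \<phi>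
    using that by (simp add: weak_value_def psi_f2 psi_A_f2 S_x C_x a_def)

  show ?thesis
    \<comment> \<open>Saturation of the bound amounts to \<open>opt\<close> together with
      \<open>eff_lim\<close>, once \<open>op\<close> evaluates the operator norm.\<close>
    unfolding information_preserving_limit_def
    using prob eff w1 w2 opt p_lim qfi_lim eff_lim op
    by (simp add: p_def S_def C_def a_def)
qed

end
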